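(* Let $\Delta\geq 1$ be an integer and let $G$ be a $\Delta$-regular graph. Then $$\gamma(G)\leq \left(1+\frac{2(\Delta-1)}{\Delta 2^{\Delta}}\right)\gamma_e(G).$$
   Context: All graphs are finite, simple, and undirected. A set $D\subseteq V(G)$ is a dominating set in $G$ if every vertex in $V(G)\setminus D$ has a neighbor in $D$; the domination number $\gamma(G)$ is the minimum cardinality of a dominating set in $G$. A matching in $G$ is a set of pairwise disjoint edges of $G$; it is maximal if it is maximal with respect to inclusion among matchings in $G$ (equivalently, the set of vertices not incident with any edge of the matching is independent). The edge domination number $\gamma_e(G)$ is the minimum size (number of edges) of a maximal matching in $G$. A graph is $\Delta$-regular if every vertex has exactly $\Delta$ neighbors. *)

theory Defs
  imports Complex_Main
begin

text \<open>A graph is given by its vertex set \<open>V\<close> and its set \<open>E\<close> of edges, each edge being the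
  two-element set of its endpoints.\<close>

definition simple_graph :: "'a set \<Rightarrow> 'a set set \<Rightarrow> bool" where
  "simple_graph V E \<longleftrightarrow> finite V \<and> (\<forall>e\<in>E. e \<subseteq> V \<and> card e = 2)"

definition neighbors :: "'a set set \<Rightarrow> 'a \<Rightarrow> 'a set" where
  "neighbors E v = {u. {u, v} \<in> E}"

definition regular_graph :: "nat \<Rightarrow> 'a set \<Rightarrow> 'a set set \<Rightarrow> bool" where
  "regular_graph \<Delta> V E \<longleftrightarrow> (\<forall>v\<in>V. card (neighbors E v) = \<Delta>)"

definition dominating_set :: "'a set \<Rightarrow> 'a set set \<Rightarrow> 'a set \<Rightarrow> bool" where
  "dominating_set V E D \<longleftrightarrow> D \<subseteq> V \<and> (\<forall>v\<in>V - D. \<exists>u\<in>D. u \<in> neighbors E v)"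

definition domination_number :: "'a set \<Rightarrow> 'a set set \<Rightarrow> nat" where
  "domination_number V E = (LEAST k. \<exists>D. dominating_set V E D \<and> card D = k)"

definition matching :: "'a set set \<Rightarrow> 'a set set \<Rightarrow> bool" where
  "matching E M \<longleftrightarrow> M \<subseteq> E \<and> pairwise disjnt M"

definition maximal_matching :: "'a set set \<Rightarrow> 'a set set \<Rightarrow> bool" where
  "maximal_matching E M \<longleftrightarrow> matching E M \<and> (\<forall>M'. matching E M' \<and> M \<subseteq> M' \<longrightarrow> M' = M)"

definition edge_domination_number :: "'a set set \<Rightarrow> nat" where
  "edge_domination_number E = (LEAST k. \<exists>M. maximal_matching E M \<and> card M = k)"

end

theory Submission
  imports Defs
begin

text \<open>Take a minimum maximal matching \<open>M\<close> and choose one endpoint of each of its edges uniformly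
  at random. The chosen vertices dominate all vertices covered by \<open>M\<close>. An uncovered vertex has all
  its \<open>\<Delta>\<close> neighbours covered; it is surely dominated if two of them form an edge of \<open>M\<close>, and otherwise
  it stays undominated with probability \<open>2 ^ -\<Delta>\<close>. Each of the \<open>2 \<bar>M\<bar>\<close> covered vertices has at most
  \<open>\<Delta> - 1\<close> uncovered neighbours, so there are at most \<open>2 \<bar>M\<bar> (\<Delta> - 1) / \<Delta>\<close> uncovered vertices.
  Adding the undominated ones to the chosen ones gives, on average, the bound.\<close>

text \<open>If \<open>A\<close> and \<open>B\<close> meet, no such \<open>S\<close> exists;
  otherwise \<open>S\<close> is free only outside \<open>A \<union> B\<close>. This is the
  probability bound for one uncovered vertex, multiplied out so that it stays in the natural
  numbers.\<close>

lemma card_subsets_avoiding_containing: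
  assumes "finite M" "A \<subseteq> M" "B \<subseteq> M"
  shows "card {S \<in> Pow M. S \<inter> A = {} \<and> B \<subseteq> S} * 2 ^ (card A + card B) \<le> 2 ^ card M"
proof (cases "A \<inter> B = {}")
  case False
  then have "{S \<in> Pow M. S \<inter> A = {} \<and> B \<subseteq> S} = {}" by blast
  then show ?thesis by (simp only: card.empty)
next
  case True
  have fin: "finite A" "finite B" using assms finite_subset by blast+
  have AB: "card (A \<union> B) = card A + card B"
    using fin True by (simp add: card_Un_disjoint)
  \<comment> \<open>Since \<open>B \<subseteq> S\<close>, nothing is lost by removing
    \<open>B\<close> from \<open>S\<close>, and what remains avoids both \<open>A\<close> and
    \<open>B\<close>.\<close>
  have "card {S \<in> Pow M. S \<inter> A = {} \<and> B \<subseteq> S} \<le> card (Pow (M - (A \<union> B)))"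
  proof (rule card_inj_on_le[where f = "\<lambda>S. S - B"])
    show "inj_on (\<lambda>S. S - B) {S \<in> Pow M. S \<inter> A = {} \<and> B \<subseteq> S}"
      by (rule inj_onI) blast
  qed (use assms in auto)
  then have "card {S \<in> Pow M. S \<inter> A = {} \<and> B \<subseteq> S} \<le> 2 ^ card (M - (A \<union> B))"
    using assms(1) by (simp add: card_Pow)
  then have "card {S \<in> Pow M. S \<inter> A = {} \<and> B \<subseteq> S} * 2 ^ (card A + card B)
      \<le> 2 ^ card (M - (A \<union> B)) * 2 ^ card (A \<union> B)"
    unfolding AB by (rule mult_right_mono) simp
  also have "\<dots> = 2 ^ card M"
  proof -
    have "card (A \<union> B) \<le> card M" using assms by (intro card_mono) auto
    then show ?thesis
      using assms fin by (simp add: card_Diff_subset flip: power_add)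
  qed
  finally show ?thesis .
qed

lemma exists_le_average:
  fixes f :: "'b \<Rightarrow> nat"
  assumes "finite P" "P \<noteq> {}" "(\<Sum>S\<in>P. f S) \<le> card P * c"
  shows "\<exists>S\<in>P. f S \<le> c"
proof (rule ccontr)
  assume "\<not> ?thesis"
  then have "(\<Sum>S\<in>P. c) < (\<Sum>S\<in>P. f S)"
    using assms by (intro sum_strict_mono) auto
  then show False using assms(3) by simp
qed

lemma neighbors_sym: "u \<in> neighbors E v \<longleftrightarrow> v \<in> neighbors E u"
  by (simp add: neighbors_def insert_commute)

lemma simple_graph_finite_edges: "simple_graph V E \<Longrightarrow> finite E"
  unfolding simple_graph_def by (auto intro: finite_subset[of E "Pow V"])

lemma neighbors_subset: "simple_graph V E \<Longrightarrow> neighbors E v \<subseteq> V"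
  unfolding simple_graph_def neighbors_def by blast

text \<open>An edge with both ends uncovered could be added to \<open>M\<close>, against
  maximality.\<close>

lemma maximal_matching_covers_edge:
  assumes "simple_graph V E" "maximal_matching E M" "{u, v} \<in> E"
  shows "u \<in> \<Union>M \<or> v \<in> \<Union>M"
proof (rule ccontr)
  assume *: "\<not> ?thesis"
  then have "matching E (insert {u, v} M)"
    using assms(2,3) unfolding maximal_matching_def matching_def
    by (auto simp: pairwise_insert disjnt_def)
  then have "{u, v} \<in> M"
    using assms(2) unfolding maximal_matching_def by blast
  then show False using * by blast
qed

text \<open>Guarantees that the \<open>LEAST\<close> in \<open>edge_domination_number\<close> is
  attained.\<close>

lemma maximal_matching_exists:
  assumes "simple_graph V E"
  shows "\<exists>M. maximal_matching E M"
proof -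
  have "finite {M. matching E M}"
    using simple_graph_finite_edges[OF assms]
    by (auto simp: matching_def intro: finite_subset[of _ "Pow E"])
  moreover have "{} \<in> {M. matching E M}" by (simp add: matching_def)
  ultimately obtain M where "M \<in> {M. matching E M}"
      "\<forall>M'\<in>{M. matching E M}. M \<subseteq> M' \<longrightarrow> M = M'"
    using finite_has_maximal[of "{M. matching E M}"] by blast
  then show ?thesis unfolding maximal_matching_def by blast
qed

text \<open>Double counting of the edges between uncovered and covered vertices: an uncovered vertex
  sends all its \<Delta> edges across, while a covered vertex uses at least one on its partner in
  \<open>M\<close>.\<close>

lemma card_uncovered_le:
  assumes "simple_graph V E" "regular_graph \<Delta> V E" "maximal_matching E M"
  shows "\<Delta> * card (V - \<Union>M) \<le> 2 * card M * (\<Delta> - 1)"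
proof -
  have finV: "finite V" and edges: "\<And>e. e \<in> E \<Longrightarrow> e \<subseteq> V \<and> card e = 2"
    using assms(1) by (auto simp: simple_graph_def)
  have ME: "M \<subseteq> E" using assms(3) by (simp add: maximal_matching_def matching_def)
  have MV: "\<Union>M \<subseteq> V" using ME edges by blast
  have finC: "finite (\<Union>M)" using MV finV finite_subset by blast
  have "\<Delta> * card (V - \<Union>M) = (\<Sum>u\<in>V - \<Union>M. card {v\<in>\<Union>M. v \<in> neighbors E u})"
  proof -
    have "card {v\<in>\<Union>M. v \<in> neighbors E u} = \<Delta>" if u: "u \<in> V - \<Union>M" for u
    proof -
      have "v \<in> \<Union>M" if "v \<in> neighbors E u" for v
        using maximal_matching_covers_edge[OF assms(1,3)] that u by (auto simp: neighbors_def)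
      then have "{v\<in>\<Union>M. v \<in> neighbors E u} = neighbors E u" by blast
      then show ?thesis using assms(2) u by (simp add: regular_graph_def)
    qed
    then show ?thesis by simp
  qed
  also have "\<dots> = (\<Sum>v\<in>\<Union>M. card {u\<in>V - \<Union>M. v \<in> neighbors E u})"
    using sum.swap_restrict[of "V - \<Union>M" "\<Union>M" "\<lambda>_ _. 1::nat" "\<lambda>u v. v \<in> neighbors E u"]
      finV finC by simp
  also have "\<dots> \<le> (\<Sum>v\<in>\<Union>M. \<Delta> - 1)"
  proof (rule sum_mono)
    fix v assume v: "v \<in> \<Union>M"
    then obtain e where e: "e \<in> M" "v \<in> e" by blast
    then have "card e = 2" using ME edges by blast
    then obtain w where w: "e = {w, v}"
      using e(2) by (auto simp: card_2_iff)
    then have wN: "w \<in> neighbors E v" using e ME by (auto simp: neighbors_def)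
    have fin: "finite (neighbors E v)"
      using neighbors_subset[OF assms(1)] finV finite_subset by blast
    \<comment> \<open>The partner \<open>w\<close> of \<open>v\<close> is itself covered, which
      accounts for the \<open>- 1\<close>.\<close>
    have "{u\<in>V - \<Union>M. v \<in> neighbors E u} \<subseteq> neighbors E v - {w}"
      using w e(1) by (auto simp: neighbors_sym[of v])
    then have "card {u\<in>V - \<Union>M. v \<in> neighbors E u} \<le> card (neighbors E v - {w})"
      using fin by (intro card_mono) auto
    also have "\<dots> = \<Delta> - 1"
      using wN fin v MV assms(2) by (auto simp: regular_graph_def card_Diff_singleton)
    finally show "card {u\<in>V - \<Union>M. v \<in> neighbors E u} \<le> \<Delta> - 1" .
  qed
  also have "\<dots> \<le> 2 * card M * (\<Delta> - 1)"
  proof -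
    have "card (\<Union>M) \<le> (\<Sum>e\<in>M. card e)"
      by (rule card_Union_le_sum_card)
    also have "\<dots> = (\<Sum>e\<in>M. 2)" using ME edges by (intro sum.cong) auto
    finally show ?thesis by (simp add: mult.commute)
  qed
  finally show ?thesis .
qed

text \<open>Here \<open>k\<close> counts the vertices left undominated by a choice of endpoints that
  does no worse than average; these are added to the chosen endpoints.\<close>

lemma exists_dominating_set:
  assumes "simple_graph V E" "regular_graph \<Delta> V E" "maximal_matching E M"
  shows "\<exists>D k. dominating_set V E D \<and> card D \<le> card M + k \<and> 2 ^ \<Delta> * k \<le> card (V - \<Union>M)"
proof -
  have finV: "finite V" and edges: "\<And>e. e \<in> E \<Longrightarrow> e \<subseteq> V \<and> card e = 2"
    using assms(1) by (auto simp: simple_graph_def)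
  have ME: "M \<subseteq> E" using assms(3) by (simp add: maximal_matching_def matching_def)
  have finM: "finite M" using ME simple_graph_finite_edges[OF assms(1)] finite_subset by blast
  have "\<forall>e\<in>M. \<exists>x y. e = {x, y}" using ME edges by (meson card_2_iff subsetD)
  then obtain a b where ab: "\<And>e. e \<in> M \<Longrightarrow> e = {a e, b e}" by metis
  define U where "U = V - \<Union>M"
  \<comment> \<open>A subset \<open>S\<close> of \<open>M\<close> encodes a choice: edges in
    \<open>S\<close> contribute their end \<open>a e\<close>, all others \<open>b e\<close>.
    Averaging over \<open>Pow M\<close> thus replaces the independent fair coin flips.\<close>
  define chosen where "chosen S = a ` S \<union> b ` (M - S)" for S
  define R where "R S = {u\<in>U. neighbors E u \<inter> chosen S = {}}" for S
  have finU: "finite U" using finV by (simp add: U_def)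
  have count: "2 ^ \<Delta> * card {S\<in>Pow M. neighbors E u \<inter> chosen S = {}} \<le> 2 ^ card M"
    if u: "u \<in> U" for u
  proof -
    \<comment> \<open>A choice \<open>S\<close> misses \<open>u\<close> only if it takes the
      \<open>b\<close>-end on \<open>A\<close> and the \<open>a\<close>-end on \<open>B\<close>. An
      edge with both ends adjacent to \<open>u\<close> lies in \<open>A \<inter> B\<close> and makes
      this impossible.\<close>
    define A where "A = {e\<in>M. a e \<in> neighbors E u}"
    define B where "B = {e\<in>M. b e \<in> neighbors E u}"
    have "neighbors E u \<subseteq> a ` A \<union> b ` B"
    proof
      fix v assume v: "v \<in> neighbors E u"
      then have "v \<in> \<Union>M"
        using maximal_matching_covers_edge[OF assms(1,3)] u by (auto simp: neighbors_def U_def)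
      then obtain e where "e \<in> M" "v \<in> e" by blast
      then show "v \<in> a ` A \<union> b ` B" using ab[of e] v by (auto simp: A_def B_def)
    qed
    then have "card (neighbors E u) \<le> card (a ` A \<union> b ` B)"
      using finM by (intro card_mono) (auto simp: A_def B_def)
    also have "\<dots> \<le> card A + card B"
      using finM by (intro order_trans[OF card_Un_le] add_mono card_image_le)
        (auto simp: A_def B_def)
    finally have "\<Delta> \<le> card A + card B" using u assms(2) by (simp add: regular_graph_def U_def)
    then have "2 ^ \<Delta> * card {S\<in>Pow M. neighbors E u \<inter> chosen S = {}}
        \<le> 2 ^ (card A + card B) * card {S\<in>Pow M. S \<inter> A = {} \<and> B \<subseteq> S}"
      using finM by (intro mult_mono card_mono power_increasing)
        (auto simp: A_def B_def chosen_def)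
    also have "\<dots> \<le> 2 ^ card M"
      using card_subsets_avoiding_containing[of M A B] finM
      by (simp add: A_def B_def mult.commute)
    finally show ?thesis .
  qed
  \<comment> \<open>Linearity of expectation: exchanging the sums counts, for each vertex, the
    choices that miss it.\<close>
  have "(\<Sum>S\<in>Pow M. 2 ^ \<Delta> * card (R S))
      = 2 ^ \<Delta> * (\<Sum>u\<in>U. card {S\<in>Pow M. neighbors E u \<inter> chosen S = {}})"
    unfolding R_def sum_distrib_left[symmetric]
    using sum.swap_restrict[of "Pow M" U "\<lambda>_ _. 1::nat"
        "\<lambda>S u. neighbors E u \<inter> chosen S = {}"] finM finU by simp
  also have "\<dots> \<le> (\<Sum>u\<in>U. 2 ^ card M)"
    unfolding sum_distrib_left by (intro sum_mono count)
  also have "\<dots> = card (Pow M) * card U" using finM by (simp add: card_Pow)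
  finally obtain S where S: "S \<subseteq> M" "2 ^ \<Delta> * card (R S) \<le> card U"
    using exists_le_average[of "Pow M" "\<lambda>S. 2 ^ \<Delta> * card (R S)" "card U"] finM by auto
  have "dominating_set V E (chosen S \<union> R S)"
    unfolding dominating_set_def
  proof (intro conjI ballI)
    show "chosen S \<union> R S \<subseteq> V"
      using S(1) ab ME edges by (fastforce simp: chosen_def R_def U_def)
    fix v assume v: "v \<in> V - (chosen S \<union> R S)"
    show "\<exists>u\<in>chosen S \<union> R S. u \<in> neighbors E v"
    proof (cases "v \<in> U")
      case True
      then show ?thesis using v by (auto simp: R_def)
    next
      \<comment> \<open>A covered vertex that is not chosen is dominated by the other end of its
        matching edge.\<close>
      case False
      then obtain e where e: "e \<in> M" "v \<in> e" using v by (auto simp: U_def)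
      then have "{a e, b e} \<in> E" "{b e, a e} \<in> E"
        using ab[OF e(1)] ME by (auto simp: insert_commute)
      moreover have "v = a e \<or> v = b e" using ab[OF e(1)] e(2) by blast
      moreover have "a e \<in> chosen S \<or> b e \<in> chosen S" using e(1) by (auto simp: chosen_def)
      ultimately show ?thesis using v unfolding neighbors_def by blast
    qed
  qed
  moreover have "card (chosen S \<union> R S) \<le> card M + card (R S)"
  proof -
    have "card (chosen S) \<le> card S + card (M - S)"
      unfolding chosen_def using finM S(1) finite_subset[OF S(1)]
      by (intro order_trans[OF card_Un_le] add_mono card_image_le) auto
    also have "\<dots> = card M"
      using finM S(1) finite_subset[OF S(1)] by (simp add: card_Diff_subset card_mono)
    finally show ?thesis using card_Un_le[of "chosen S" "R S"] by linarith
  qed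
  ultimately show ?thesis using S(2) unfolding U_def by blast
qed

theorem theorem1:
  fixes V :: "'a set" and E :: "'a set set" and \<Delta> :: nat
  assumes "\<Delta> \<ge> 1"
    and "simple_graph V E"
    and "regular_graph \<Delta> V E"
  shows "real (domination_number V E)
    \<le> (1 + 2 * (real \<Delta> - 1) / (real \<Delta> * 2 ^ \<Delta>)) * real (edge_domination_number E)"
proof -
  obtain M where M: "maximal_matching E M" "card M = edge_domination_number E"
    unfolding edge_domination_number_def
    using LeastI_ex[of "\<lambda>k. \<exists>M. maximal_matching E M \<and> card M = k"]
      maximal_matching_exists[OF assms(2)] by blast
  obtain D k where D: "dominating_set V E D" "card D \<le> card M + k"
      and k: "2 ^ \<Delta> * k \<le> card (V - \<Union>M)"
    using exists_dominating_set[OF assms(2,3) M(1)] by blast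
  have "domination_number V E \<le> card D"
    unfolding domination_number_def using D(1) by (intro Least_le) blast
  then have le: "real (domination_number V E) \<le> real (card M) + real k" using D(2) by linarith
  \<comment> \<open>Multiplying by \<Delta> lets the two bounds chain without division.\<close>
  have "\<Delta> * (2 ^ \<Delta> * k) \<le> \<Delta> * card (V - \<Union>M)" using k by simp
  also have "\<dots> \<le> 2 * card M * (\<Delta> - 1)" by (rule card_uncovered_le[OF assms(2,3) M(1)])
  finally have "real (\<Delta> * (2 ^ \<Delta> * k)) \<le> real (2 * card M * (\<Delta> - 1))"
    by (simp only: of_nat_le_iff)
  \<comment> \<open>As \<Delta> is positive, the truncated \<open>\<Delta> - 1\<close> agrees with
    the real difference and dividing by \<open>\<Delta> * 2 ^ \<Delta>\<close> is sound.\<close>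
  then have "real k \<le> 2 * (real \<Delta> - 1) / (real \<Delta> * 2 ^ \<Delta>) * real (card M)"
    using assms(1) by (simp add: of_nat_diff field_simps)
  then show ?thesis using le M(2) by (simp add: algebra_simps)
qed

end
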